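(* Let $X$ and $Y$ be real-valued random variables on a common probability space (each of $X$, $Y$ may be discrete, continuous, or mixed), with $E[|Y|]<\infty$. Let $F^{\mathrm{mid}}(\cdot\,;X)$ be the mid-distribution function of $X$. Then $$E[Y\mid X]\,=\,E\big[Y\mid F^{\mathrm{mid}}(X;X)\big]\quad\text{with probability }1.$$
   Context: For a real random variable $X$, write $F(x;X)=\Pr[X\le x]$ for its distribution function and $p(x;X)=\Pr[X=x]$. The mid-distribution function of $X$ is $$F^{\mathrm{mid}}(x;X)=F(x;X)-\tfrac12\,p(x;X),\qquad x\in\mathbb{R}.$$ The mid-distribution transform $F^{\mathrm{mid}}(X;X)$ is the random variable obtained by evaluating the function $x\mapsto F^{\mathrm{mid}}(x;X)$ at the random point $x=X$. Here $E[Y\mid X]$ and $E[Y\mid F^{\mathrm{mid}}(X;X)]$ denote conditional expectations given the sigma-algebras generated by $X$ and by $F^{\mathrm{mid}}(X;X)$, respectively. *)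

theory Defs
  imports "HOL-Probability.Probability"
begin

definition mid_cdf :: "'a measure \<Rightarrow> ('a \<Rightarrow> real) \<Rightarrow> real \<Rightarrow> real" where
  "mid_cdf M X x = \<P>(\<omega> in M. X \<omega> \<le> x) - (1 / 2) * \<P>(\<omega> in M. X \<omega> = x)"

text \<open>The conditional expectation of \<open>Y\<close> given the sigma-algebra generated by the real
  random variable \<open>Z\<close>. As with \<^const>\<open>real_cond_exp\<close>, this is one version, determined
  up to null sets. It is meaningful only for \<open>Z\<close> measurable and \<open>Y\<close> integrable: if \<open>Z\<close> is not
  measurable, \<^const>\<open>real_cond_exp\<close> is the zero function. (The mid-distribution transform is
  measurable, since the mid-distribution function is nondecreasing.)\<close>

definition cond_exp_given :: "'a measure \<Rightarrow> ('a \<Rightarrow> real) \<Rightarrow> ('a \<Rightarrow> real) \<Rightarrow> 'a \<Rightarrow> real" where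
  "cond_exp_given M Y Z = real_cond_exp M (vimage_algebra (space M) Z borel) Y"

end

theory Submission
  imports Defs
begin

text \<open>
  Write \<open>G\<close> for the mid-distribution function of \<open>X\<close>. The sigma-algebra of \<open>G(X)\<close> is contained in
  that of \<open>X\<close>, since \<open>G\<close> is monotone, and the containment can be strict, because \<open>G\<close> may be constant
  on an interval. But \<open>G\<close> rises by at least \<open>P(a < X \<le> b) / 2\<close> between \<open>a\<close> and \<open>b\<close>
  (\<open>prob_le_mid_cdf_diff\<close>), so where it is constant \<open>X\<close> has no mass. Consequently
  \<open>{X \<le> a}\<close> and \<open>{G(X) \<le> G(a)}\<close> differ by a null set (\<open>AE_le_iff_mid_cdf_le\<close>). The half-lines generate
  the Borel sets, so every event of the larger sigma-algebra agrees, up to a null set, with one of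
  the smaller (\<open>vimage_algebra_AE_subset\<close>). Conditional expectations are characterised by
  their integrals over the conditioning events, and such integrals do not see null sets; hence
  the two conditional expectations agree almost surely (\<open>real_cond_exp_AE_eq_subalgebra\<close>).
\<close>

text \<open>The version given the smaller algebra \<open>G\<close> is already a version given \<open>F\<close>: it is
  \<open>F\<close>-measurable, and its integral over an event of \<open>F\<close> can be computed over an almost equal
  event of \<open>G\<close>.\<close>

lemma real_cond_exp_AE_eq_subalgebra:
  fixes Y :: "'a \<Rightarrow> real"
  assumes "finite_measure M" and F: "subalgebra M F" and G: "subalgebra F G"
    and Y: "integrable M Y"
    and approx: "\<And>A. A \<in> sets F \<Longrightarrow> \<exists>B\<in>sets G. AE \<omega> in M. \<omega> \<in> A \<longleftrightarrow> \<omega> \<in> B"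
  shows "AE \<omega> in M. real_cond_exp M F Y \<omega> = real_cond_exp M G Y \<omega>"
proof -
  interpret finite_measure M by fact
  have MG: "subalgebra M G"
    using F G by (auto simp: subalgebra_def)
  interpret F: finite_measure_subalgebra M F
    by unfold_locales (rule F)
  interpret G: finite_measure_subalgebra M G
    by unfold_locales (rule MG)
  have same_integral: "(LINT \<omega>:B|M. f \<omega>) = (LINT \<omega>:A|M. f \<omega>)"
    if "A \<in> sets M" "B \<in> sets M" "AE \<omega> in M. \<omega> \<in> A \<longleftrightarrow> \<omega> \<in> B" "integrable M f"
    for A B and f :: "'a \<Rightarrow> real"
    using that by (intro set_integral_cong_set) (auto simp: set_borel_measurable_def)
  show ?thesis
  proof (rule F.real_cond_exp_charact)
    fix A assume A: "A \<in> sets F"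
    then obtain B where B: "B \<in> sets G" "AE \<omega> in M. \<omega> \<in> A \<longleftrightarrow> \<omega> \<in> B"
      using approx by blast
    have AB: "A \<in> sets M" "B \<in> sets M"
      using A B F MG by (auto simp: subalgebra_def)
    have "(LINT \<omega>:A|M. Y \<omega>) = (LINT \<omega>:B|M. Y \<omega>)"
      using same_integral[OF AB B(2) Y] by simp
    also have "\<dots> = (LINT \<omega>:B|M. real_cond_exp M G Y \<omega>)"
      by (rule G.real_cond_exp_intA[OF Y B(1)])
    also have "\<dots> = (LINT \<omega>:A|M. real_cond_exp M G Y \<omega>)"
      by (rule same_integral[OF AB B(2) G.real_cond_exp_int(1)[OF Y]])
    finally show "(LINT \<omega>:A|M. Y \<omega>) = (LINT \<omega>:A|M. real_cond_exp M G Y \<omega>)" .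
  next
    show "real_cond_exp M G Y \<in> borel_measurable F"
      by (rule measurable_from_subalg[OF G borel_measurable_cond_exp])
  qed (use Y G.real_cond_exp_int(1)[OF Y] in auto)
qed

text \<open>The events that agree almost everywhere with an event of \<open>G\<close> are closed under complements and
  countable unions, so it suffices to treat the generating half-lines.\<close>

lemma vimage_algebra_AE_subset:
  fixes X :: "'a \<Rightarrow> real"
  assumes G: "space G = space M"
    and half_lines: "\<And>a. \<exists>B\<in>sets G. AE \<omega> in M. X \<omega> \<le> a \<longleftrightarrow> \<omega> \<in> B"
    and A: "A \<in> sets (vimage_algebra (space M) X borel)"
  shows "\<exists>B\<in>sets G. AE \<omega> in M. \<omega> \<in> A \<longleftrightarrow> \<omega> \<in> B"
proof -
  obtain S where S: "S \<in> sets borel" "A = X -` S \<inter> space M"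
    using A by (auto simp: sets_vimage_algebra2)
  have "S \<in> sigma_sets UNIV (range atMost)"
    using S(1) by (subst (asm) borel_eq_atMost) simp
  then have "\<exists>B\<in>sets G. AE \<omega> in M. X \<omega> \<in> S \<longleftrightarrow> \<omega> \<in> B"
  proof induction
    case (Basic S)
    then show ?case using half_lines by auto
  next
    case Empty
    show ?case by (intro bexI[of _ "{}"]) auto
  next
    case (Compl S)
    then obtain B where B: "B \<in> sets G" "AE \<omega> in M. X \<omega> \<in> S \<longleftrightarrow> \<omega> \<in> B"
      by blast
    have "AE \<omega> in M. X \<omega> \<in> UNIV - S \<longleftrightarrow> \<omega> \<in> space G - B"
      using B(2) AE_space by eventually_elim (simp add: G)
    with B(1) show ?case by blast
  next
    case (Union S)
    then obtain B where B: "\<And>i. B i \<in> sets G" "\<And>i. AE \<omega> in M. X \<omega> \<in> S i \<longleftrightarrow> \<omega> \<in> B i"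
      by metis
    have "AE \<omega> in M. \<forall>i::nat. X \<omega> \<in> S i \<longleftrightarrow> \<omega> \<in> B i"
      using B(2) by (simp add: AE_all_countable)
    then have "AE \<omega> in M. X \<omega> \<in> (\<Union>i. S i) \<longleftrightarrow> \<omega> \<in> (\<Union>i. B i)"
      by eventually_elim simp
    with B(1) show ?case by blast
  qed
  then obtain B where B: "B \<in> sets G" "AE \<omega> in M. X \<omega> \<in> S \<longleftrightarrow> \<omega> \<in> B"
    by blast
  have "AE \<omega> in M. \<omega> \<in> A \<longleftrightarrow> \<omega> \<in> B"
    using B(2) AE_space by eventually_elim (simp add: S(2))
  with B(1) show ?thesis by blast
qed

context prob_space
begin

text \<open>The increment of the mid-distribution function is
  \<open>P(a < X \<le> b) - P(X = b) / 2 + P(X = a) / 2\<close>, and \<open>P(X = b) \<le> P(a < X \<le> b)\<close>.\<close>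

lemma prob_le_mid_cdf_diff:
  assumes [measurable]: "X \<in> borel_measurable M" and "a < b"
  shows "\<P>(\<omega> in M. a < X \<omega> \<and> X \<omega> \<le> b) \<le> 2 * (mid_cdf M X b - mid_cdf M X a)"
proof -
  have "\<P>(\<omega> in M. X \<omega> \<le> b)
      = prob ({\<omega>\<in>space M. X \<omega> \<le> a} \<union> {\<omega>\<in>space M. a < X \<omega> \<and> X \<omega> \<le> b})"
    using \<open>a < b\<close> by (intro arg_cong[where f = prob]) auto
  also have "\<dots> = \<P>(\<omega> in M. X \<omega> \<le> a) + \<P>(\<omega> in M. a < X \<omega> \<and> X \<omega> \<le> b)"
    by (rule finite_measure_Union) auto
  finally have "\<P>(\<omega> in M. X \<omega> \<le> b)
      = \<P>(\<omega> in M. X \<omega> \<le> a) + \<P>(\<omega> in M. a < X \<omega> \<and> X \<omega> \<le> b)" .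
  moreover have "\<P>(\<omega> in M. X \<omega> = b) \<le> \<P>(\<omega> in M. a < X \<omega> \<and> X \<omega> \<le> b)"
    using \<open>a < b\<close> by (intro finite_measure_mono) auto
  moreover have "0 \<le> \<P>(\<omega> in M. X \<omega> = a)"
    by simp
  ultimately show ?thesis
    unfolding mid_cdf_def by (simp add: algebra_simps add_increasing)
qed

lemma mono_mid_cdf:
  assumes "X \<in> borel_measurable M"
  shows "mono (mid_cdf M X)"
proof (rule monoI)
  fix a b :: real assume "a \<le> b"
  then show "mid_cdf M X a \<le> mid_cdf M X b"
    using order_trans[OF measure_nonneg prob_le_mid_cdf_diff[OF assms, of a b]]
    by (cases "a = b") auto
qed

lemma AE_not_between_if_mid_cdf_eq:
  assumes [measurable]: "X \<in> borel_measurable M" and "a < b" "mid_cdf M X a = mid_cdf M X b"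
  shows "AE \<omega> in M. \<not> (a < X \<omega> \<and> X \<omega> \<le> b)"
proof -
  have "\<P>(\<omega> in M. a < X \<omega> \<and> X \<omega> \<le> b) = 0"
    using prob_le_mid_cdf_diff[OF assms(1,2)] assms(3) by (simp add: measure_le_0_iff)
  then show ?thesis
    by (subst (asm) prob_eq_0) auto
qed

text \<open>The two events differ where \<open>X\<close> exceeds \<open>a\<close> but lies in the set \<open>L\<close> of points to the right
  of \<open>a\<close> at which the mid-distribution function still has its value at \<open>a\<close>. Each \<open>(a, b]\<close> with
  \<open>b \<in> L\<close> carries no mass, and countably many of these cover \<open>L\<close>: those with \<open>b\<close> rational and,
  if \<open>L\<close> has a greatest element, the one ending there.\<close>

lemma AE_le_iff_mid_cdf_le:
  assumes X: "X \<in> borel_measurable M"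
  shows "AE \<omega> in M. X \<omega> \<le> a \<longleftrightarrow> mid_cdf M X (X \<omega>) \<le> mid_cdf M X a"
proof -
  let ?G = "mid_cdf M X"
  note mono = monoD[OF mono_mid_cdf[OF X]]
  define L where "L = {b. a < b \<and> ?G a = ?G b}"
  define D where "D = (L \<inter> \<rat>) \<union> {m\<in>L. \<forall>b\<in>L. b \<le> m}"
  have "{m\<in>L. \<forall>b\<in>L. b \<le> m} \<subseteq> {Sup L}"
    by (auto intro!: cSup_eq_maximum[symmetric])
  then have "countable D"
    unfolding D_def by (auto intro: countable_subset countable_rat)
  have "AE \<omega> in M. \<forall>b\<in>D. \<not> (a < X \<omega> \<and> X \<omega> \<le> b)"
    unfolding AE_ball_countable[OF \<open>countable D\<close>]
    using AE_not_between_if_mid_cdf_eq[OF X] by (auto simp: D_def L_def)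
  then show ?thesis
  proof eventually_elim
    case (elim \<omega>)
    have covered: "\<exists>b\<in>D. x \<le> b" if x: "x \<in> L" for x
    proof (cases "\<forall>b\<in>L. b \<le> x")
      case True
      with x show ?thesis by (auto simp: D_def)
    next
      case False
      then obtain b where b: "b \<in> L" "x < b" by auto
      then obtain q where q: "q \<in> \<rat>" "x < q" "q < b"
        using Rats_dense_in_real by blast
      have "?G q = ?G a"
        using x b q mono[of x q] mono[of q b] by (auto simp: L_def)
      with x q have "q \<in> D" by (auto simp: D_def L_def)
      with q show ?thesis by (auto intro: less_imp_le)
    qed
    show ?case
    proof
      assume "X \<omega> \<le> a"
      then show "?G (X \<omega>) \<le> ?G a" by (rule mono)
    next
      assume le: "?G (X \<omega>) \<le> ?G a"
      show "X \<omega> \<le> a"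
      proof (rule ccontr)
        assume "\<not> X \<omega> \<le> a"
        with le mono[of a "X \<omega>"] have "X \<omega> \<in> L" by (auto simp: L_def)
        with covered elim show False by (auto simp: L_def)
      qed
    qed
  qed
qed

end

theorem mainTheorem1:
  fixes M :: "'a measure" and X Y :: "'a \<Rightarrow> real"
  assumes "prob_space M"
    and "X \<in> borel_measurable M"
    and "Y \<in> borel_measurable M"
    and "integrable M (\<lambda>\<omega>. \<bar>Y \<omega>\<bar>)"
  shows "AE \<omega> in M. cond_exp_given M Y X \<omega>
           = cond_exp_given M Y (\<lambda>\<omega>'. mid_cdf M X (X \<omega>')) \<omega>"
proof -
  interpret prob_space M by fact
  let ?Z = "\<lambda>\<omega>. mid_cdf M X (X \<omega>)"
  let ?F = "vimage_algebra (space M) X borel"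
  let ?G = "vimage_algebra (space M) ?Z borel"
  have F: "subalgebra M ?F"
    using assms(2) by (simp add: subalgebra_def sets_image_in_sets)
  have "X \<in> borel_measurable ?F"
    by (rule measurable_vimage_algebra1) simp
  then have "?Z \<in> borel_measurable ?F"
    using borel_measurable_mono[OF mono_mid_cdf[OF assms(2)]] by measurable
  then have G: "subalgebra ?F ?G"
    by (simp add: subalgebra_def sets_image_in_sets)
  have half_lines: "\<exists>B\<in>sets ?G. AE \<omega> in M. X \<omega> \<le> a \<longleftrightarrow> \<omega> \<in> B" for a
  proof
    show "?Z -` {..mid_cdf M X a} \<inter> space M \<in> sets ?G"
      by (rule in_vimage_algebra) simp
    show "AE \<omega> in M. X \<omega> \<le> a \<longleftrightarrow> \<omega> \<in> ?Z -` {..mid_cdf M X a} \<inter> space M"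
      using AE_le_iff_mid_cdf_le[OF assms(2), of a] AE_space by eventually_elim simp
  qed
  have Y: "integrable M Y"
    using assms(3,4) by (simp add: integrable_abs_iff)
  show ?thesis
    unfolding cond_exp_given_def
    by (rule real_cond_exp_AE_eq_subalgebra[OF finite_measure_axioms F G Y])
      (rule vimage_algebra_AE_subset[OF _ half_lines], simp_all)
qed

end
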